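(* Let $\phi:\mathbb{R}^n\to\mathbb{R}$ be convex and twice continuously differentiable, attaining its minimum, with $\nabla\phi$ Lipschitz-continuous with constant $L>0$. Let $\alpha=3$ and $\beta=0$. Then for every $z\notin\mathrm{argmin}(\phi)$, the restarting time $T(z)$ satisfies $$T(z)\ \ge\ \sqrt{\frac{6}{5L}}.$$
   Context: For $z\in\mathbb{R}^n$, let $y_z\in C^2((0,+\infty);\mathbb{R}^n)\cap C^1([0,+\infty);\mathbb{R}^n)$ be the (unique) solution of $\ddot x(t)+\frac{3}{t}\dot x(t)+\nabla\phi(x(t))=0$ $(t>0)$ with $y_z(0)=z$, $\dot y_z(0)=0$. The restarting time is $T(z)=\inf\{t>0:\ \frac{d}{dt}\|\dot y_z(t)\|^2\le0\}$. *)

theory Defs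
  imports "HOL-Analysis.Analysis"
begin

definition grad :: "('a::real_inner \<Rightarrow> real) \<Rightarrow> 'a \<Rightarrow> 'a" where
  "grad \<phi> x = (THE d. GDERIV \<phi> x :> d)"

lemma grad_eqI:
  assumes "GDERIV \<phi> x :> d"
  shows "grad \<phi> x = d"
  unfolding grad_def
proof (rule the_equality)
  fix e assume "GDERIV \<phi> x :> e"
  with assms have "(\<lambda>h. inner h e) = (\<lambda>h. inner h d)"
    unfolding gderiv_def by (rule has_derivative_unique[rotated])
  then show "e = d"
    by (metis vector_eq_ldot)
qed (fact assms)

text \<open>Twice continuously differentiable: the gradient exists everywhere and is itself
  continuously differentiable. \<open>H x\<close> is the Hessian as a bounded linear map, and continuity
  of \<open>H\<close> is in the operator norm.\<close>

definition twice_cont_differentiable :: "('a::real_inner \<Rightarrow> real) \<Rightarrow> bool" where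
  "twice_cont_differentiable \<phi> \<longleftrightarrow>
     (\<forall>x. GDERIV \<phi> x :> grad \<phi> x) \<and>
     (\<exists>H :: 'a \<Rightarrow> ('a \<Rightarrow>\<^sub>L 'a).
        (\<forall>x. (grad \<phi> has_derivative blinfun_apply (H x)) (at x)) \<and>
        continuous_on UNIV H)"

definition argmin :: "('a \<Rightarrow> real) \<Rightarrow> 'a set" where
  "argmin \<phi> = {x. is_arg_min \<phi> (\<lambda>_. True) x}"

text \<open>The curve \<open>y\<close> is a function on all of \<open>\<real>\<close>, but only its values on \<open>[0,\<infinity>)\<close> matter:
  the derivative \<open>v\<close> is one-sided at \<open>0\<close>. Continuity of \<open>v\<close> on \<open>[0,\<infinity>)\<close> and of \<open>a\<close> on
  \<open>(0,\<infinity>)\<close> express \<open>C\<^sup>1([0,\<infinity>))\<close> and \<open>C\<^sup>2((0,\<infinity>))\<close>.\<close>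

definition is_solution ::
    "('a::real_inner \<Rightarrow> real) \<Rightarrow> 'a \<Rightarrow> (real \<Rightarrow> 'a) \<Rightarrow> bool" where
  "is_solution \<phi> z y \<longleftrightarrow>
     (\<exists>v a. (\<forall>t\<ge>0. (y has_vector_derivative v t) (at t within {0..})) \<and>
            continuous_on {0..} v \<and>
            (\<forall>t>0. (v has_vector_derivative a t) (at t)) \<and>
            continuous_on {0<..} a \<and>
            (\<forall>t>0. a t + (3 / t) *\<^sub>R v t + grad \<phi> (y t) = 0) \<and>
            y 0 = z \<and> v 0 = 0)"

text \<open>Extended-real valued, so that the infimum of the empty set is \<open>\<infinity>\<close>.\<close>

definition restart_time :: "(real \<Rightarrow> 'a::real_normed_vector) \<Rightarrow> ereal" where
  "restart_time y =
     Inf (ereal ` {t. t > 0 \<and> deriv (\<lambda>s. (norm (vector_derivative y (at s)))\<^sup>2) t \<le> 0})"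

end

theory Submission
  imports Defs
begin

text \<open>Write \<open>v = y'\<close>, \<open>a = y''\<close>, \<open>g s = grad \<phi> (y s)\<close>, and let \<open>M\<close> be the supremum of \<open>norm (v s) / s\<close> on
  \<open>(0,t]\<close>, so that \<open>norm (g r - g s) \<le> L M (r\<^sup>2 - s\<^sup>2) / 2\<close> for \<open>0 \<le> s < r \<le> t\<close>. Since \<open>s\<^sup>3 v\<close> has derivative \<open>- s\<^sup>3 g\<close>,
  comparing it with \<open>- s\<^sup>4 g 0 / 4\<close> and with \<open>- s\<^sup>4 g t / 4\<close> gives
  \<open>norm (v t + t g 0 / 4) \<le> L M t\<^sup>3 / 12\<close> and \<open>norm (v t - t a t) \<le> L M t\<^sup>3 / 6\<close>.
  The first estimate bounds \<open>M\<close> from above and \<open>norm (v t)\<close> from below in terms of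
  \<open>norm (g 0)\<close>; with the second one this forces \<open>v t \<bullet> a t > 0\<close>. The argument works as long as
  \<open>L t\<^sup>2 < 3\<close>, which is weaker than \<open>L t\<^sup>2 < 6/5\<close>.\<close>

text \<open>Restricted to the line through \<open>z\<close> and \<open>x\<close>, a convex function
  stays above its tangent at \<open>z\<close>, which is horizontal here. This is what turns
  \<open>z \<notin> argmin \<phi>\<close> into a nonzero initial gradient.\<close>

lemma convex_grad_zero_imp_argmin:
  fixes \<phi> :: "'a::real_inner \<Rightarrow> real"
  assumes "convex_on UNIV \<phi>" and "GDERIV \<phi> z :> 0"
  shows "z \<in> argmin \<phi>"
proof -
  have "\<phi> z \<le> \<phi> x" for x
  proof -
    define f where "f u = \<phi> (z + u *\<^sub>R (x - z))" for u :: real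
    have "convex_on UNIV f"
    proof (rule convex_onI)
      fix s a b :: real assume s: "0 < s" "s < 1"
      have "f ((1 - s) *\<^sub>R a + s *\<^sub>R b)
          = \<phi> ((1 - s) *\<^sub>R (z + a *\<^sub>R (x - z)) + s *\<^sub>R (z + b *\<^sub>R (x - z)))"
        unfolding f_def by (rule arg_cong[where f=\<phi>]) (simp add: algebra_simps)
      also have "\<dots> \<le> (1 - s) * f a + s * f b"
        unfolding f_def using s by (intro convex_onD[OF assms(1)]) auto
      finally show "f ((1 - s) *\<^sub>R a + s *\<^sub>R b) \<le> (1 - s) * f a + s * f b" .
    qed auto
    moreover have "(f has_real_derivative 0) (at 0)"
    proof -
      have "(\<phi> has_derivative (\<lambda>h. 0)) (at (z + 0 *\<^sub>R (x - z)))"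
        using assms(2) by (simp add: gderiv_def)
      moreover have "((\<lambda>u::real. z + u *\<^sub>R (x - z)) has_derivative (\<lambda>u. u *\<^sub>R (x - z))) (at 0)"
        by (auto intro!: derivative_eq_intros)
      ultimately have "((\<lambda>u. \<phi> (z + u *\<^sub>R (x - z))) has_derivative (\<lambda>u. 0)) (at (0::real))"
        by (rule has_derivative_compose[rotated])
      then show ?thesis
        by (simp add: f_def[abs_def] has_field_derivative_def lambda_zero)
    qed
    ultimately have "f 1 - f 0 \<ge> 0 * (1 - 0)"
      by (intro convex_on_imp_above_tangent[where A=UNIV]) auto
    then show ?thesis by (simp add: f_def)
  qed
  then show ?thesis
    by (simp add: argmin_def is_arg_min_def not_less)
qed

text \<open>\<open>s ^ 3\<close> is the integrating factor of the damping \<open>3 / s\<close>: in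
  the derivative of \<open>s ^ 3 *\<^sub>R v s + (s ^ 4 / 4) *\<^sub>R c\<close> the velocity
  cancels and \<open>s ^ 3 *\<^sub>R (c - g s)\<close> remains. The reference value \<open>c\<close>
  will be 0, \<open>g 0\<close> and \<open>g t\<close> in turn.\<close>

lemma damped_velocity_bound:
  fixes v g :: "real \<Rightarrow> 'a::real_normed_vector"
  assumes "r > 0" and "continuous_on {0..} v"
    and "\<And>s. s > 0 \<Longrightarrow> (v has_vector_derivative - (3 / s) *\<^sub>R v s - g s) (at s)"
    and "\<And>s. (P has_real_derivative P' s) (at s)" and "P 0 = 0"
    and "\<And>s. 0 < s \<Longrightarrow> s < r \<Longrightarrow> s ^ 3 * norm (g s - c) \<le> P' s"
  shows "norm (r ^ 3 *\<^sub>R v r + (r ^ 4 / 4) *\<^sub>R c) \<le> P r"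
proof -
  define F where "F s = s ^ 3 *\<^sub>R v s + (s ^ 4 / 4) *\<^sub>R c" for s :: real
  have "norm (F r - F 0) \<le> P r - P 0"
  \<comment> \<open>Derivatives are required only inside the interval, so the singularity of
    \<open>3 / s\<close> at 0 does no harm.\<close>
  proof (rule differentiable_bound_general[OF \<open>r > 0\<close>])
    show "continuous_on {0..r} F"
      unfolding F_def by (intro continuous_intros continuous_on_subset[OF assms(2)]) auto
    show "continuous_on {0..r} P"
      using assms(4) by (intro continuous_at_imp_continuous_on) (auto intro: DERIV_isCont)
    show "(P has_vector_derivative P' s) (at s)" for s
      using assms(4) by (simp add: has_real_derivative_iff_has_vector_derivative)
    fix s assume s: "0 < s" "s < r"
    show "(F has_vector_derivative s ^ 3 *\<^sub>R (c - g s)) (at s)"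
    proof -
      have 1: "((\<lambda>s. s ^ 3) has_real_derivative 3 * s\<^sup>2) (at s)"
        by (auto intro!: derivative_eq_intros)
      have 2: "((\<lambda>s. s ^ 4 / 4) has_real_derivative s ^ 3) (at s)"
        by (auto intro!: derivative_eq_intros)
      have "((\<lambda>s. s ^ 3 *\<^sub>R v s + (s ^ 4 / 4) *\<^sub>R c) has_vector_derivative
          (s ^ 3 *\<^sub>R (- (3 / s) *\<^sub>R v s - g s) + (3 * s\<^sup>2) *\<^sub>R v s)
          + ((s ^ 4 / 4) *\<^sub>R 0 + s ^ 3 *\<^sub>R c)) (at s)"
        by (intro has_vector_derivative_add has_vector_derivative_scaleR 1 2
            assms(3)[OF s(1)] has_vector_derivative_const)
      moreover have "s ^ 3 * (3 / s) = 3 * s\<^sup>2"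
        using s by (simp add: power3_eq_cube power2_eq_square)
      ultimately show ?thesis
        by (simp add: F_def[abs_def] scaleR_diff_right)
    qed
    show "norm (s ^ 3 *\<^sub>R (c - g s)) \<le> P' s"
      using assms(6)[OF s] s by (simp add: norm_minus_commute)
  qed
  then show ?thesis by (simp add: F_def assms(5))
qed

lemma inner_velocity_acceleration_pos:
  fixes y v a :: "real \<Rightarrow> 'a::real_inner" and G :: "'a \<Rightarrow> 'a"
  assumes L: "L > 0" and lip: "L-lipschitz_on UNIV G"
    and y: "\<And>t. t \<ge> 0 \<Longrightarrow> (y has_vector_derivative v t) (at t within {0..})"
    and v: "continuous_on {0..} v"
    and a: "\<And>t. t > 0 \<Longrightarrow> (v has_vector_derivative a t) (at t)"
    and ode: "\<And>t. t > 0 \<Longrightarrow> a t + (3 / t) *\<^sub>R v t + G (y t) = 0"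
    and G0: "G (y 0) \<noteq> 0" and t: "t > 0" and small: "L * t\<^sup>2 < 3"
  shows "v t \<bullet> a t > 0"
proof -
  define g where "g = (\<lambda>s. G (y s))"
  have y_cont: "continuous_on {0..} y"
    using y by (auto simp: continuous_on_eq_continuous_within intro: has_vector_derivative_continuous)
  have y_at: "(y has_vector_derivative v s) (at s)" if "s > 0" for s
    using y[of s] that at_within_interior[of s "{0..}"] by simp
  have v': "(v has_vector_derivative - (3 / s) *\<^sub>R v s - g s) (at s)" if "s > 0" for s
  proof -
    have "a s = - (3 / s) *\<^sub>R v s - g s"
      using ode[OF that] by (simp add: g_def eq_diff_eq eq_neg_iff_add_eq_0 ac_simps)
    with a[OF that] show ?thesis by simp
  qed
  have "bounded (g ` {0..t})"
    unfolding g_def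
    by (intro compact_imp_bounded compact_continuous_image continuous_on_compose2[OF lipschitz_on_continuous_on[OF lip]]
        continuous_on_subset[OF y_cont]) auto
  then obtain K where K: "\<And>s. 0 \<le> s \<Longrightarrow> s \<le> t \<Longrightarrow> norm (g s) \<le> K"
    unfolding bounded_iff by (metis atLeastAtMost_iff imageI)
  \<comment> \<open>A crude bound, with reference value 0, that makes the supremum \<open>M\<close>
    finite.\<close>
  have vK: "norm (v s) / s \<le> K / 4" if "0 < s" "s \<le> t" for s
  proof -
    have "norm (s ^ 3 *\<^sub>R v s + (s ^ 4 / 4) *\<^sub>R 0) \<le> K * s ^ 4 / 4"
      by (rule damped_velocity_bound[OF that(1) v v', where P = "\<lambda>s. K * s ^ 4 / 4" and P' = "\<lambda>s. K * s ^ 3"])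
        (use that K in \<open>auto intro!: derivative_eq_intros simp: mult.commute intro: mult_right_mono\<close>)
    then have "s ^ 3 * norm (v s) \<le> s ^ 3 * (K / 4 * s)"
      using that by (simp add: power4_eq_xxxx power3_eq_cube algebra_simps)
    then have "norm (v s) \<le> K / 4 * s"
      using that by (subst (asm) mult_le_cancel_left_pos) auto
    then show ?thesis using that by (simp add: pos_divide_le_eq)
  qed
  define M where "M = (SUP s\<in>{0<..t}. norm (v s) / s)"
  have vM: "norm (v s) \<le> M * s" if "0 < s" "s \<le> t" for s
  proof -
    have "norm (v s) / s \<le> M"
      unfolding M_def using that vK
      by (intro cSUP_upper bdd_aboveI2[where M = "K / 4"]) auto
    then show ?thesis using that by (simp add: pos_divide_le_eq)
  qed
  have M0: "M \<ge> 0"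
    using vM[of t] t by (meson norm_ge_zero order_trans order_refl zero_le_mult_iff not_le)
  have g_diff: "norm (g r - g s) \<le> L * M * (r\<^sup>2 - s\<^sup>2) / 2" if "0 \<le> s" "s < r" "r \<le> t" for r s
  proof -
    have "norm (y r - y s) \<le> M * r\<^sup>2 / 2 - M * s\<^sup>2 / 2"
    proof (rule differentiable_bound_general[OF \<open>s < r\<close>])
      show "continuous_on {s..r} y"
        by (rule continuous_on_subset[OF y_cont]) (use that in auto)
      show "continuous_on {s..r} (\<lambda>s. M * s\<^sup>2 / 2)" by (intro continuous_intros) auto
      fix x assume x: "s < x" "x < r"
      show "(y has_vector_derivative v x) (at x)" using y_at x that by simp
      show "((\<lambda>s. M * s\<^sup>2 / 2) has_vector_derivative M * x) (at x)"
        by (auto simp flip: has_real_derivative_iff_has_vector_derivative intro!: derivative_eq_intros)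
      show "norm (v x) \<le> M * x" using vM x that by simp
    qed
    then have "L * norm (y r - y s) \<le> L * (M * r\<^sup>2 / 2 - M * s\<^sup>2 / 2)"
      using L by simp
    moreover have "norm (g r - g s) \<le> L * norm (y r - y s)"
      using lipschitz_onD[OF lip, of "y r" "y s"] by (simp add: g_def dist_norm)
    ultimately show ?thesis by (simp add: algebra_simps diff_divide_distrib)
  qed
  \<comment> \<open>The integral of \<open>s ^ 3 * (L * M * s\<^sup>2 / 2)\<close> is
    \<open>L * M * r ^ 6 / 12\<close>. All \<open>r \<le> t\<close> are covered because the bound on
    \<open>M\<close> takes a supremum over them.\<close>
  have from_start: "norm (v r + (r / 4) *\<^sub>R g 0) \<le> L * M * r ^ 3 / 12" if "0 < r" "r \<le> t" for r
  proof -
    have bound: "norm (r ^ 3 *\<^sub>R v r + (r ^ 4 / 4) *\<^sub>R g 0) \<le> L * M * r ^ 6 / 12"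
    proof (rule damped_velocity_bound[OF that(1) v v', where P = "\<lambda>s. L * M * s ^ 6 / 12"
          and P' = "\<lambda>s. L * M * s ^ 5 / 2"])
      fix s assume s: "0 < s" "s < r"
      have "s ^ 3 * norm (g s - g 0) \<le> s ^ 3 * (L * M * s\<^sup>2 / 2)"
        using g_diff[of 0 s] s that by (intro mult_left_mono) auto
      then show "s ^ 3 * norm (g s - g 0) \<le> L * M * s ^ 5 / 2"
        by (simp add: eval_nat_numeral algebra_simps)
    qed (auto intro!: derivative_eq_intros)
    have factor: "r ^ 3 *\<^sub>R v r + (r ^ 4 / 4) *\<^sub>R g 0 = r ^ 3 *\<^sub>R (v r + (r / 4) *\<^sub>R g 0)"
      by (simp add: scaleR_add_right eval_nat_numeral mult.assoc)
    have "r ^ 3 * norm (v r + (r / 4) *\<^sub>R g 0) \<le> L * M * r ^ 6 / 12"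
      using bound that unfolding factor by simp
    also have "\<dots> = r ^ 3 * (L * M * r ^ 3 / 12)"
      by (simp add: eval_nat_numeral)
    finally have "r ^ 3 * norm (v r + (r / 4) *\<^sub>R g 0) \<le> r ^ 3 * (L * M * r ^ 3 / 12)" .
    then show ?thesis using that by (subst (asm) mult_le_cancel_left_pos) auto
  qed
  \<comment> \<open>With reference value \<open>g t\<close>, the equation at time \<open>t\<close>
    brings in \<open>a t\<close>. The constant is 4 * (1/8 - 1/12) = 1/6.\<close>
  have from_end: "norm (v t - t *\<^sub>R a t) \<le> L * M * t ^ 3 / 6"
  proof -
    have bound: "norm (t ^ 3 *\<^sub>R v t + (t ^ 4 / 4) *\<^sub>R g t) \<le> L * M * (t ^ 4 * t\<^sup>2 / 8 - t ^ 6 / 12)"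
    proof (rule damped_velocity_bound[OF t v v', where P = "\<lambda>s. L * M * (s ^ 4 * t\<^sup>2 / 8 - s ^ 6 / 12)"
          and P' = "\<lambda>s. L * M * (s ^ 3 * t\<^sup>2 / 2 - s ^ 5 / 2)"])
      fix s assume s: "0 < s" "s < t"
      have "s ^ 3 * norm (g t - g s) \<le> s ^ 3 * (L * M * (t\<^sup>2 - s\<^sup>2) / 2)"
        using g_diff[of s t] s by (intro mult_left_mono) auto
      then show "s ^ 3 * norm (g s - g t) \<le> L * M * (s ^ 3 * t\<^sup>2 / 2 - s ^ 5 / 2)"
        by (simp add: eval_nat_numeral algebra_simps norm_minus_commute diff_divide_distrib)
    qed (auto intro!: derivative_eq_intros)
    have factor: "t ^ 3 *\<^sub>R v t + (t ^ 4 / 4) *\<^sub>R g t = (t ^ 3 / 4) *\<^sub>R (v t - t *\<^sub>R a t)"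
    proof -
      have "g t = - a t - (3 / t) *\<^sub>R v t"
        using ode[OF t] by (simp add: g_def eq_diff_eq eq_neg_iff_add_eq_0 ac_simps)
      moreover have "t ^ 4 / 4 * (3 / t) = 3 * t ^ 3 / 4"
        using t by (simp add: eval_nat_numeral)
      ultimately have "t ^ 3 *\<^sub>R v t + (t ^ 4 / 4) *\<^sub>R g t
          = (t ^ 3 - 3 * t ^ 3 / 4) *\<^sub>R v t - (t ^ 4 / 4) *\<^sub>R a t"
        by (simp only: scaleR_diff_right scaleR_diff_left scaleR_scaleR scaleR_minus_right) simp
      also have "\<dots> = (t ^ 3 / 4) *\<^sub>R (v t - t *\<^sub>R a t)"
        by (simp add: scaleR_diff_right eval_nat_numeral mult.assoc)
      finally show ?thesis .
    qed
    have "t ^ 3 / 4 * norm (v t - t *\<^sub>R a t) \<le> L * M * (t ^ 4 * t\<^sup>2 / 8 - t ^ 6 / 12)"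
      using bound t unfolding factor by simp
    also have "\<dots> = t ^ 3 / 4 * (L * M * t ^ 3 / 6)"
      by (simp add: eval_nat_numeral)
    finally have "t ^ 3 / 4 * norm (v t - t *\<^sub>R a t) \<le> t ^ 3 / 4 * (L * M * t ^ 3 / 6)" .
    then show ?thesis using t by (subst (asm) mult_le_cancel_left_pos) auto
  qed
  \<comment> \<open>\<open>M\<close> occurs on both sides; the smallness of
    \<open>L * t\<^sup>2\<close> lets the right-hand occurrence be absorbed next.\<close>
  have M_le: "M \<le> norm (g 0) / 4 + L * M * t\<^sup>2 / 12"
    unfolding M_def
  proof (rule cSUP_least)
    fix r assume "r \<in> {0<..t}"
    then have r: "0 < r" "r \<le> t" by auto
    have "norm (v r) \<le> norm ((r / 4) *\<^sub>R g 0) + norm (v r + (r / 4) *\<^sub>R g 0)"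
      by (metis add.commute add_diff_cancel_right' norm_triangle_ineq4)
    also have "\<dots> \<le> r / 4 * norm (g 0) + L * M * r ^ 3 / 12"
      using from_start[OF r] r by simp
    also have "\<dots> = r * (norm (g 0) / 4 + L * M * r\<^sup>2 / 12)"
      by (simp add: eval_nat_numeral algebra_simps)
    finally have "norm (v r) / r \<le> norm (g 0) / 4 + L * M * r\<^sup>2 / 12"
      using r by (simp add: pos_divide_le_eq mult.commute)
    also have "L * M * r\<^sup>2 \<le> L * M * t\<^sup>2"
      using r L M0 by (intro mult_left_mono power_mono) auto
    finally show "norm (v r) / r \<le> norm (g 0) / 4 +
        L * (SUP s\<in>{0<..t}. norm (v s) / s) * t\<^sup>2 / 12"
      by (simp add: M_def)
  qed (use t in auto)
  have key: "L * M * t\<^sup>2 < norm (g 0)"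
  proof (cases "M = 0")
    case True
    then show ?thesis using G0 by (simp add: g_def)
  next
    case False
    \<comment> \<open>If \<open>L * M * t\<^sup>2\<close> is q, then \<open>M_le\<close> reads 12 M
      \<le> 3 \<open>norm (g 0)\<close> + q, and q < 3 M gives 4 q < 12 M, hence q <
      \<open>norm (g 0)\<close>.\<close>
    then have "M * (L * t\<^sup>2) < M * 3"
      using M0 small by (intro mult_strict_left_mono) auto
    with M_le show ?thesis by (simp add: algebra_simps)
  qed
  have "t / 4 * norm (g 0) \<le> norm (v t) + norm (v t + (t / 4) *\<^sub>R g 0)"
  proof -
    have "norm ((t / 4) *\<^sub>R g 0) \<le> norm (v t + (t / 4) *\<^sub>R g 0) + norm (v t)"
      by (metis add_diff_cancel_left' norm_triangle_ineq4)
    then show ?thesis using t by simp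
  qed
  moreover have "L * M * t ^ 3 < t * norm (g 0)"
    using mult_strict_left_mono[OF key t] by (simp add: eval_nat_numeral ac_simps)
  \<comment> \<open>Here 1/4 - 1/12 = 1/6, exactly the constant in \<open>from_end\<close>.\<close>
  ultimately have "L * M * t ^ 3 / 6 < norm (v t)"
    using from_start[OF t order_refl] by linarith
  with from_end have lt: "norm (v t - t *\<^sub>R a t) < norm (v t)" by linarith
  \<comment> \<open>\<open>t *\<^sub>R a t\<close> lies closer to \<open>v t\<close> than the origin
    does, so its inner product with \<open>v t\<close> is positive.\<close>
  have "v t \<bullet> (v t - t *\<^sub>R a t) \<le> norm (v t) * norm (v t - t *\<^sub>R a t)"
    by (rule norm_cauchy_schwarz)
  also have "\<dots> < norm (v t) * norm (v t)"
    using lt le_less_trans[OF norm_ge_zero lt] by (rule mult_strict_left_mono)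
  finally have "t * (v t \<bullet> a t) > 0"
    by (simp add: inner_diff_right dot_square_norm power2_eq_square)
  then show ?thesis using t by (simp add: zero_less_mult_iff)
qed

theorem mainTheorem2:
  fixes \<phi> :: "real ^ 'n \<Rightarrow> real" and L :: real
    and z :: "real ^ 'n" and y :: "real \<Rightarrow> real ^ 'n"
  assumes "convex_on UNIV \<phi>"
    and "twice_cont_differentiable \<phi>"
    and "argmin \<phi> \<noteq> {}"
    and "L > 0"
    and "L-lipschitz_on UNIV (grad \<phi>)"
    and "z \<notin> argmin \<phi>"
    and "is_solution \<phi> z y"
  shows "restart_time y \<ge> ereal (sqrt (6 / (5 * L)))"
proof -
  obtain v a where y: "\<And>t. t \<ge> 0 \<Longrightarrow> (y has_vector_derivative v t) (at t within {0..})"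
    and v: "continuous_on {0..} v"
    and a: "\<And>t. t > 0 \<Longrightarrow> (v has_vector_derivative a t) (at t)"
    and ode: "\<And>t. t > 0 \<Longrightarrow> a t + (3 / t) *\<^sub>R v t + grad \<phi> (y t) = 0"
    and y0: "y 0 = z"
    using assms(7) unfolding is_solution_def by blast
  have "GDERIV \<phi> z :> grad \<phi> z"
    using assms(2) by (simp add: twice_cont_differentiable_def)
  then have G0: "grad \<phi> (y 0) \<noteq> 0"
    using convex_grad_zero_imp_argmin[OF assms(1), of z] assms(6) y0 by auto
  have y': "vector_derivative y (at s) = v s" if "s > 0" for s
    using y[of s] that at_within_interior[of s "{0..}"] by (simp add: vector_derivative_at)
  have "sqrt (6 / (5 * L)) \<le> t"
    if t: "t > 0" and le: "deriv (\<lambda>s. (norm (vector_derivative y (at s)))\<^sup>2) t \<le> 0" for t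
  proof (rule ccontr)
    assume "\<not> sqrt (6 / (5 * L)) \<le> t"
    then have "t\<^sup>2 < (sqrt (6 / (5 * L)))\<^sup>2"
      using t by (intro power_strict_mono) auto
    \<comment> \<open>In fact \<open>L * t\<^sup>2\<close> is below 6/5.\<close>
    then have "L * t\<^sup>2 < 3"
      using \<open>L > 0\<close> by (simp add: field_simps)
    then have pos: "v t \<bullet> a t > 0"
      using inner_velocity_acceleration_pos[OF assms(4,5) y v a ode G0 t] by blast
    have "((\<lambda>s. v s \<bullet> v s) has_derivative (\<lambda>h. v t \<bullet> (h *\<^sub>R a t) + (h *\<^sub>R a t) \<bullet> v t)) (at t)"
      using a[OF t] unfolding has_vector_derivative_def by (intro has_derivative_inner) auto
    then have "((\<lambda>s. v s \<bullet> v s) has_real_derivative 2 * (v t \<bullet> a t)) (at t)"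
      by (rule has_derivative_imp_has_field_derivative) (simp add: inner_commute)
    \<comment> \<open>The sign of \<open>deriv\<close> is informative only once the derivative is
      known to exist. It is carried over from \<open>v s \<bullet> v s\<close> on the open
      half-line, where \<open>vector_derivative y (at s)\<close> equals \<open>v s\<close>.\<close>
    then have "((\<lambda>s. (norm (vector_derivative y (at s)))\<^sup>2) has_real_derivative 2 * (v t \<bullet> a t)) (at t)"
      by (rule has_field_derivative_transform_within_open[where S = "{0<..}"])
        (use t y' in \<open>auto simp: dot_square_norm\<close>)
    with le pos show False by (simp add: DERIV_imp_deriv)
  qed
  then show ?thesis
    unfolding restart_time_def by (intro Inf_greatest) auto
qed

end
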